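(* Let $s\ge 1$ be an integer, let $n$ be an integer with $n\ge 4s+1$ and $n\equiv 3\pmod{2s-1}$, and put $m=n+1$. Then there exists a supersequence of size (length) $$m^2-\frac{5s-3}{2s-1}\,m+\frac{2s^2+9s-7}{2s-1}$$ over a set of $m$ letters.
   Context: A supersequence over a finite set $A$ is a finite sequence of elements of $A$ that contains every permutation of $A$ (every sequence listing each element of $A$ exactly once) as a subsequence, i.e. each permutation can be obtained from it by deleting zero or more elements and keeping the order of the others. The size of a sequence is its length. *)

theory Defs
  imports Complex_Main "HOL-Library.Sublist" "HOL-Number_Theory.Cong"
    "HOL-Combinatorics.Multiset_Permutations"
begin

definition supersequence :: "'a set \<Rightarrow> 'a list \<Rightarrow> bool" where
  "supersequence A xs \<longleftrightarrow>
     finite A \<and> set xs \<subseteq> A \<and> (\<forall>p \<in> permutations_of_set A. subseq p xs)"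

end

theory Submission
  imports Defs
begin

text \<open>
  Put a separator letter \<open>x\<close> around blocks \<open>B 1, \<dots>, B n\<close> of the other \<open>n\<close> letters: the sequence
  \<open>x B 1 x B 2 x \<dots> x B n x\<close> is a supersequence as soon as every list of \<open>i\<close> distinct letters fits into the
  first \<open>i\<close> blocks and into the last \<open>i\<close> blocks. For the first condition block \<open>j + 1\<close> may miss the last
  letter of block \<open>j\<close>. It may also miss the last but one letter \<open>v\<close>, provided that every list of length
  \<open>j\<close> that needs all of the first \<open>j\<close> blocks contains \<open>v\<close>.

  Fix \<open>s - 1\<close> skip letters. Initially they are the letters missing one after the other, so that a list
  reaching the end of its blocks has used all of them. Later, a list of length \<open>j\<close> ending at a letter
  that is next missing from block \<open>b\<close> and not fitting into fewer blocks lacks at most \<open>b - 1 - j\<close> skip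
  letters, because the letters it reads near the block ends occur in the order in which they go
  missing; this only requires each letter to move to the end of the blocks \<open>s - 1\<close> (for skip letters) or
  \<open>s\<close> (for other letters) blocks before it is missing. By symmetry a skip letter stays near the beginning
  for \<open>s - 1\<close> blocks afterwards, so it can be skipped once in every \<open>2 s - 1\<close> blocks.
\<close>

section \<open>Subsequences and words made of blocks\<close>

lemma subseq_rev: "subseq xs ys \<Longrightarrow> subseq (rev xs) (rev ys)"
proof (induction rule: list_emb.induct)
  case (list_emb_Cons xs ys y)
  then show ?case by (simp add: subseq_rev_drop_many)
next
  case (list_emb_Cons2 x y xs ys)
  then show ?case by (auto intro: list_emb_append_mono)
qed simp

lemma subseq_append_notin:
  assumes "subseq (p @ [a]) (xs @ ys)" "a \<notin> set ys"
  shows "subseq (p @ [a]) xs"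
  using assms(1)
proof (rule subseq_appendE)
  fix us vs
  assume uv: "p @ [a] = us @ vs" "subseq us xs" "subseq vs ys"
  have "set vs \<subseteq> set ys" using uv(3) by (metis subseq_order.dual_order.refl set_nths_subset subseq_conv_nths)
  then have "vs = []" using uv(1) assms(2)
    by (metis append_butlast_last_id last_appendR last_in_set last_snoc subset_iff)
  with uv show ?thesis by simp
qed

lemma dropWhile_split:
  assumes "a \<in> set xs"
  shows "xs = takeWhile (\<lambda>x. x \<noteq> a) xs @ a # tl (dropWhile (\<lambda>x. x \<noteq> a) xs)"
  using assms by (induction xs) auto

fun word_upto :: "(nat \<Rightarrow> 'a list) \<Rightarrow> nat \<Rightarrow> 'a list" where
  "word_upto B 0 = []"
| "word_upto B (Suc j) = word_upto B j @ B (Suc j)"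

text \<open>If \<open>a\<close> does not occur in \<open>xs\<close>, then \<open>tl [] = []\<close>
  makes the relation false.\<close>

definition follows :: "'a list \<Rightarrow> 'a \<Rightarrow> 'a \<Rightarrow> bool" where
  "follows xs a b \<longleftrightarrow> b \<in> set (tl (dropWhile (\<lambda>x. x \<noteq> a) xs))"

lemma follows_in_set: "follows xs a b \<Longrightarrow> b \<in> set xs"
  unfolding follows_def by (metis empty_iff list.sel(2) list.set(1) list.set_sel(2) set_dropWhileD)

text \<open>If \<open>p\<close> fitted before the first \<open>a\<close> of block
  \<open>Suc j\<close>, this \<open>a\<close> would extend it. So the last letter of
  \<open>p\<close> has to be read behind that \<open>a\<close>.\<close>

lemma stuck_step:
  assumes fits: "subseq p (word_upto B (Suc j))"
    and a: "a \<in> set (B (Suc j))" "a \<notin> set p" "p \<noteq> []"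
    and nfits: "\<not> subseq (p @ [a]) (word_upto B (Suc j))"
  obtains p' b where "p = p' @ [b]" "follows (B (Suc j)) a b" "\<not> subseq p (word_upto B j)"
proof -
  obtain p' b where p: "p = p' @ [b]" using a(3) by (metis rev_exhaust)
  let ?pre = "takeWhile (\<lambda>x. x \<noteq> a) (B (Suc j))"
  let ?post = "tl (dropWhile (\<lambda>x. x \<noteq> a) (B (Suc j)))"
  have W: "word_upto B (Suc j) = (word_upto B j @ ?pre) @ [a] @ ?post"
    using dropWhile_split[OF a(1)] by simp
  have n1: "\<not> subseq p (word_upto B j @ ?pre)"
  proof
    assume "subseq p (word_upto B j @ ?pre)"
    then have "subseq (p @ [a]) ((word_upto B j @ ?pre) @ [a] @ ?post)"
      by (intro list_emb_append_mono) auto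
    then show False using nfits W by simp
  qed
  have "b \<in> set ?post"
  proof (rule ccontr)
    assume "b \<notin> set ?post"
    then have "subseq p (word_upto B j @ ?pre)"
      using subseq_append_notin[of p' b "word_upto B j @ ?pre" "[a] @ ?post"] fits a(2)
      unfolding W p by auto
    then show False using n1 by simp
  qed
  moreover have "\<not> subseq p (word_upto B j)"
    using n1 by (meson list_emb_append2 subseq_rev_drop_many)
  ultimately show ?thesis using that p unfolding follows_def by blast
qed

lemma follows_sorted:
  assumes "sorted (map f xs)" "distinct xs" "follows xs a b"
  shows "f a \<le> f b" "a \<noteq> b"
proof -
  have "a \<in> set xs"
  proof (rule ccontr)
    assume "a \<notin> set xs"
    then have "dropWhile (\<lambda>x. x \<noteq> a) xs = []" by (auto simp: dropWhile_eq_Nil_conv)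
    from assms(3)[unfolded follows_def this] show False by simp
  qed
  moreover define us vs where
    "us = takeWhile (\<lambda>x. x \<noteq> a) xs" and "vs = tl (dropWhile (\<lambda>x. x \<noteq> a) xs)"
  ultimately have "xs = us @ a # vs" "b \<in> set vs"
    using dropWhile_split[of a xs] assms(3) by (simp_all add: follows_def)
  then show "f a \<le> f b" "a \<noteq> b" using assms(1,2) by (auto simp: sorted_append)
qed

section \<open>Induction on the number of blocks\<close>

text \<open>
  The level of a letter \<open>a\<close> of block \<open>j\<close> bounds the number of letters of \<open>V\<close> that can be missing
  from a list of length \<open>j\<close> ending in \<open>a\<close> that does not fit into the first \<open>j - 1\<close> blocks.
\<close>
locale levelled_blocks =
  fixes B :: "nat \<Rightarrow> 'a list" and U V :: "'a set" and level :: "nat \<Rightarrow> 'a \<Rightarrow> nat" and n :: nat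
  assumes finite_V: "finite V"
    and first: "set (B 1) = U"
    and level_first: "a \<in> U \<Longrightarrow> card V \<le> level 1 a + of_bool (a \<in> V)"
    and level_step: "1 \<le> j \<Longrightarrow> j < n \<Longrightarrow> a \<in> set (B (Suc j)) \<Longrightarrow>
      card V \<le> level (Suc j) a + of_bool (a \<in> V) \<or>
      a \<in> set (B j) \<and> (\<forall>b. follows (B j) a b \<longrightarrow> level j b \<le> level (Suc j) a + of_bool (a \<in> V))"
    and absent: "1 \<le> j \<Longrightarrow> j < n \<Longrightarrow> a \<in> U \<Longrightarrow> a \<notin> set (B (Suc j)) \<Longrightarrow>
      a \<in> set (B j) \<and> (\<forall>b. follows (B j) a b \<longrightarrow> a \<in> V \<and> level j b = 0)"
begin

text \<open>Appending a letter of \<open>V\<close> leaves one letter of \<open>V\<close> fewer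
  missing; this gain is the summand \<open>of_bool (a \<in> V)\<close> in the level
  conditions.\<close>

lemma card_diff_snoc:
  assumes "a \<notin> set p" "card (V - set p) \<le> l + of_bool (a \<in> V)"
  shows "card (V - set (p @ [a])) \<le> l"
proof -
  have "V - set (p @ [a]) = (V - set p) - {a}" by auto
  then show ?thesis using assms finite_V
    by (cases "a \<in> V") (auto simp: card_Diff_singleton_if)
qed

definition fits :: "nat \<Rightarrow> bool" where
  "fits j \<longleftrightarrow> (\<forall>p. distinct p \<and> set p \<subseteq> U \<and> length p = j \<longrightarrow> subseq p (word_upto B j))"

definition bounded :: "nat \<Rightarrow> bool" where
  "bounded j \<longleftrightarrow> (\<forall>p a. distinct (p @ [a]) \<and> set (p @ [a]) \<subseteq> U \<and> length p = j \<and> a \<in> set (B (Suc j)) \<and>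
     \<not> subseq (p @ [a]) (word_upto B j) \<longrightarrow> card (V - set (p @ [a])) \<le> level (Suc j) a)"

lemma bounded_0: "bounded 0"
  unfolding bounded_def
proof (intro allI impI, elim conjE)
  fix p a
  assume "distinct (p @ [a])" "set (p @ [a]) \<subseteq> U" "length p = 0"
  then show "card (V - set (p @ [a])) \<le> level (Suc 0) a"
    using level_first[of a] by (intro card_diff_snoc) auto
qed

text \<open>Unless the bound is trivial, \<open>stuck_step\<close> shows that \<open>p\<close> needs
  block \<open>Suc j\<close> and ends there in a letter \<open>b\<close> behind \<open>a\<close>.
  The bound for \<open>b\<close> then passes on to \<open>a\<close> through
  \<open>level_step\<close>.\<close>

lemma bounded_Suc:
  assumes "Suc j < n" "fits (Suc j)" "bounded j"
  shows "bounded (Suc j)"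
  unfolding bounded_def
proof (intro allI impI, elim conjE)
  fix p a
  assume p: "distinct (p @ [a])" "set (p @ [a]) \<subseteq> U" "length p = Suc j"
    and a: "a \<in> set (B (Suc (Suc j)))" and nfits: "\<not> subseq (p @ [a]) (word_upto B (Suc j))"
  have "card (V - set p) \<le> level (Suc (Suc j)) a + of_bool (a \<in> V)"
  proof (cases "card V \<le> level (Suc (Suc j)) a + of_bool (a \<in> V)")
    case True
    then show ?thesis using card_mono[of V "V - set p"] finite_V by fastforce
  next
    case False
    then have a': "a \<in> set (B (Suc j))"
      and lev: "\<And>b. follows (B (Suc j)) a b \<Longrightarrow> level (Suc j) b \<le> level (Suc (Suc j)) a + of_bool (a \<in> V)"
      using level_step[of "Suc j" a] assms(1) a by auto
    have "subseq p (word_upto B (Suc j))" using assms(2) p unfolding fits_def by auto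
    moreover have "a \<notin> set p" "p \<noteq> []" using p by auto
    ultimately obtain p' b
      where pb: "p = p' @ [b]" "follows (B (Suc j)) a b" "\<not> subseq p (word_upto B j)"
      using stuck_step[of p B j a] a' nfits by metis
    then have "b \<in> set (B (Suc j))" by (simp add: follows_in_set)
    then have "card (V - set p) \<le> level (Suc j) b"
      using assms(3) pb p unfolding bounded_def by auto
    then show ?thesis using lev[OF pb(2)] by simp
  qed
  then show "card (V - set (p @ [a])) \<le> level (Suc (Suc j)) a"
    using p by (intro card_diff_snoc) auto
qed

text \<open>A failing list ends in a letter \<open>a\<close> missing from block
  \<open>Suc j\<close>, and the rest \<open>p\<close> ends in a letter behind \<open>a\<close> in
  block \<open>j\<close>. Level 0 there forces all of \<open>V\<close> into \<open>p\<close>, yet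
  \<open>a\<close> lies in \<open>V\<close> and not in \<open>p\<close>.\<close>

lemma fits_Suc:
  assumes "Suc j \<le> n" "fits j" "j > 0 \<Longrightarrow> bounded (j - 1)"
  shows "fits (Suc j)"
  unfolding fits_def
proof (intro allI impI, elim conjE)
  fix pa
  assume pa: "distinct pa" "set pa \<subseteq> U" "length pa = Suc j"
  then obtain p a where p: "pa = p @ [a]" by (metis append_butlast_last_id length_0_conv nat.distinct(1))
  have fp: "subseq p (word_upto B j)" using assms(2) pa p unfolding fits_def by auto
  show "subseq pa (word_upto B (Suc j))"
  proof (rule ccontr)
    assume nf: "\<not> ?thesis"
    have aB: "a \<notin> set (B (Suc j))"
    proof
      assume "a \<in> set (B (Suc j))"
      then have "subseq [a] (B (Suc j))" by (simp add: subseq_singleton_left)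
      then show False using nf fp unfolding p by (simp add: list_emb_append_mono)
    qed
    \<comment> \<open>Block 1 contains every letter, so \<open>j\<close> is positive.\<close>
    then obtain i where i: "j = Suc i" using first pa p by (cases j) auto
    have nf': "\<not> subseq (p @ [a]) (word_upto B j)"
      using nf list_emb_append2[of "(=)" pa "word_upto B j" "B (Suc j)"] subseq_append' unfolding p
      by (metis append_Nil2 list_emb_append_mono list_emb_Nil word_upto.simps(2))
    have ab: "a \<in> set (B j)" and skip: "\<And>b. follows (B j) a b \<Longrightarrow> a \<in> V \<and> level j b = 0"
      using absent[of j a] assms(1) i pa p aB by auto
    have "a \<notin> set p" "p \<noteq> []" using pa p i by auto
    then obtain p' b where pb: "p = p' @ [b]" "follows (B j) a b" "\<not> subseq p (word_upto B i)"
      using stuck_step[of p B i a] ab fp nf' unfolding i by metis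
    then have "b \<in> set (B j)" by (simp add: follows_in_set)
    then have "card (V - set p) \<le> level j b"
      using assms(3) pb pa p unfolding bounded_def i by auto
    then have "V \<subseteq> set p" using skip[OF pb(2)] finite_V by auto
    then show False using skip[OF pb(2)] pa p by auto
  qed
qed

lemma fits_upto: "j \<le> n \<Longrightarrow> fits j"
proof -
  \<comment> \<open>\<open>bounded i\<close> speaks of block \<open>Suc i\<close>, hence the
    restriction \<open>i < n\<close>; \<open>bounded (Suc j)\<close> is derived from
    \<open>fits (Suc j)\<close>, so both go through one induction.\<close>
  have "j \<le> n \<longrightarrow> (\<forall>i\<le>j. fits i \<and> (i < n \<longrightarrow> bounded i))" for j
  proof (induction j)
    case 0
    then show ?case using bounded_0 by (auto simp: fits_def)
  next
    case (Suc j)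
    show ?case
    proof
      assume j: "Suc j \<le> n"
      then have IH: "\<And>i. i \<le> j \<Longrightarrow> fits i \<and> bounded i" using Suc by auto
      then have "fits (Suc j)" using j by (intro fits_Suc) auto
      moreover have "bounded (Suc j)" if "Suc j < n"
        using bounded_Suc[OF that \<open>fits (Suc j)\<close>] IH by auto
      ultimately show "\<forall>i\<le>Suc j. fits i \<and> (i < n \<longrightarrow> bounded i)"
        using IH by (auto simp: le_Suc_eq)
    qed
  qed
  then show "j \<le> n \<Longrightarrow> fits j" by blast
qed

lemma subseq_word_upto:
  assumes "distinct p" "set p \<subseteq> U" "length p \<le> n"
  shows "subseq p (word_upto B (length p))"
  using fits_upto[OF assms(3)] assms unfolding fits_def by auto

end

section \<open>Inserting the separator letter\<close>

lemma word_upto_conv_concat: "word_upto B n = concat (map B [1..<Suc n])"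
  by (induction n) auto

text \<open>Reduces the condition on the last \<open>i\<close> blocks to one on the first
  \<open>i\<close> blocks of the reversed sequence.\<close>

lemma word_upto_rev:
  assumes "i \<le> n"
  shows "word_upto (\<lambda>j. rev (B (Suc n - j))) i = rev (concat (map B [Suc (n - i)..<Suc n]))"
  using assms
proof (induction i)
  case (Suc i)
  have "[Suc (n - Suc i)..<Suc n] = (n - i) # [Suc (n - i)..<Suc n]"
    using Suc.prems upt_conv_Cons[of "n - i" "Suc n"] by (simp add: Suc_diff_Suc del: upt_Suc)
  then show ?case using Suc by (simp add: Suc_diff_Suc)
qed auto

lemma subseq_concat_interleave:
  "subseq (concat (map B js)) (concat (map (\<lambda>j. B j @ [x]) js))"
  by (induction js) (auto intro!: list_emb_append_mono)

text \<open>The final \<open>x\<close> is read at the separator behind the last block, or at the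
  leading \<open>x\<close> if \<open>js\<close> is empty.\<close>

lemma subseq_concat_interleave_left:
  "subseq (concat (map B js) @ [x]) (x # concat (map (\<lambda>j. B j @ [x]) js))"
proof (cases js rule: rev_cases)
  case (snoc ks k)
  have "subseq (concat (map B ks)) (x # concat (map (\<lambda>j. B j @ [x]) ks))"
    using subseq_concat_interleave by (metis list_emb_Cons)
  then have "subseq (concat (map B ks) @ B k @ [x]) ((x # concat (map (\<lambda>j. B j @ [x]) ks)) @ B k @ [x])"
    by (rule list_emb_append_mono) simp
  then show ?thesis using snoc by simp
qed simp

text \<open>Split a permutation as \<open>us @ x # vs\<close>. Since
  \<open>length us + length vs = n\<close>, the first \<open>length us\<close> blocks serve
  \<open>us\<close>, the separator behind them serves \<open>x\<close>, and the remaining blocks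
  serve \<open>vs\<close>.\<close>

lemma supersequence_interleave:
  assumes "finite U" "card U = n" "x \<notin> U"
    and sub: "\<And>j. j \<in> {1..n} \<Longrightarrow> set (B j) \<subseteq> U"
    and left: "\<And>p. distinct p \<Longrightarrow> set p \<subseteq> U \<Longrightarrow> subseq p (concat (map B [1..<Suc (length p)]))"
    and right: "\<And>p. distinct p \<Longrightarrow> set p \<subseteq> U \<Longrightarrow> subseq p (concat (map B [Suc (n - length p)..<Suc n]))"
  shows "supersequence (insert x U) (x # concat (map (\<lambda>j. B j @ [x]) [1..<Suc n]))"
proof -
  let ?C = "\<lambda>j. B j @ [x]"
  have "subseq p (x # concat (map ?C [1..<Suc n]))" if "p \<in> permutations_of_set (insert x U)" for p
  proof -
    have p: "set p = insert x U" "distinct p" using that by (auto simp: permutations_of_set_def)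
    then obtain us vs where uv: "p = us @ x # vs" by (metis insertI1 split_list)
    then have d: "distinct us" "distinct vs" "set us \<subseteq> U" "set vs \<subseteq> U" using p by auto
    have "length p = Suc n" using p assms by (metis card_insert_disjoint distinct_card)
    then have len: "length us + length vs = n" using uv by simp
    have "subseq (us @ [x]) (concat (map B [1..<Suc (length us)]) @ [x])"
      using left[OF d(1,3)] by (intro list_emb_append_mono) auto
    also have "subseq \<dots> (x # concat (map ?C [1..<Suc (length us)]))"
      by (rule subseq_concat_interleave_left)
    finally have l: "subseq (us @ [x]) (x # concat (map ?C [1..<Suc (length us)]))" .
    have "subseq vs (concat (map B [Suc (length us)..<Suc n]))"
      using right[OF d(2,4)] len by (metis add_diff_cancel_right')
    also have "subseq \<dots> (concat (map ?C [Suc (length us)..<Suc n]))"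
      by (rule subseq_concat_interleave)
    finally have r: "subseq vs (concat (map ?C [Suc (length us)..<Suc n]))" .
    have "[1..<Suc n] = [1..<Suc (length us)] @ [Suc (length us)..<Suc n]"
      using len upt_add_eq_append[of 1 "Suc (length us)" "length vs"] by simp
    then have "x # concat (map ?C [1..<Suc n]) =
        (x # concat (map ?C [1..<Suc (length us)])) @ concat (map ?C [Suc (length us)..<Suc n])"
      by (metis append_Cons concat_append map_append)
    moreover have "subseq ((us @ [x]) @ vs) \<dots>"
      by (rule list_emb_append_mono[OF l r])
    ultimately show ?thesis using uv by simp
  qed
  moreover have "set (x # concat (map ?C [1..<Suc n])) \<subseteq> insert x U"
  proof -
    have "set (x # concat (map ?C [1..<Suc n])) \<subseteq> insert x (\<Union>j\<in>{1..n}. set (B j))"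
      by (auto simp: less_Suc_eq_le)
    then show ?thesis using sub by blast
  qed
  ultimately show ?thesis using assms(1) unfolding supersequence_def by blast
qed

lemma supersequence_map:
  assumes "supersequence A xs" "inj_on f A"
  shows "supersequence (f ` A) (map f xs)"
  unfolding supersequence_def
proof (intro conjI ballI)
  show "finite (f ` A)" "set (map f xs) \<subseteq> f ` A" using assms unfolding supersequence_def by auto
  fix p assume "p \<in> permutations_of_set (f ` A)"
  then have p: "set p = f ` A" "distinct p" by (auto simp: permutations_of_set_def)
  let ?g = "the_inv_into A f"
  have inv: "inj_on ?g (set p)" "?g ` set p = A"
    using assms(2) p by (simp_all add: inj_on_the_inv_into the_inv_into_onto)
  then have "map ?g p \<in> permutations_of_set A"
    using p by (auto simp: permutations_of_set_def distinct_map)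
  then have "subseq (map f (map ?g p)) (map f xs)"
    using assms(1) unfolding supersequence_def by (intro subseq_map) auto
  moreover have "map f (map ?g p) = p"
    using p by (auto simp: f_the_inv_into_f[OF assms(2)] intro!: map_idI)
  ultimately show "subseq p (map f xs)" by simp
qed

section \<open>The blocks that miss a skip letter\<close>

text \<open>
  The letters \<open>1, \<dots>, r\<close> (with \<open>r = s - 1\<close>) are the skip letters, \<open>r + 1\<close> separates the blocks, and a letter
  \<open>a\<close> with \<open>r + 2 \<le> a < n - r\<close> is missing from block \<open>a\<close> only.
\<close>
locale skip_letters =
  fixes r k n :: nat
  assumes k_ge: "k \<ge> 2" and n_eq: "n = (2 * r + 1) * k + 3"
begin

lemma n_ge: "n \<ge> 4 * r + 5"
proof -
  have "(2 * r + 1) * 2 \<le> (2 * r + 1) * k" using k_ge by (intro mult_left_mono) auto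
  then show ?thesis using n_eq by simp
qed

text \<open>
  The skip letter \<open>t\<close> is missing from the blocks \<open>exit t 0, \<dots>, exit t k\<close>. Between two of them it stands first
  near the beginning of the blocks and, from block \<open>turn t m\<close> on, near their end. The values for \<open>m > k\<close> are
  dummies beyond the last block.
\<close>
definition exit :: "nat \<Rightarrow> nat \<Rightarrow> nat" where
  "exit t m = (if m = 0 then t + 1
     else if m < k then r + 2 + 2 * t + (2 * r + 1) * (m - 1)
     else if m = k then n - r - 1 + t else n + m)"

text \<open>Phases with \<open>1 < m < k\<close> keep the end position for the last \<open>r\<close>
  blocks before the exit. The cases \<open>m = 1\<close> and \<open>m = k\<close> are mirror images;
  turns of dummy phases lie beyond block \<open>n\<close>.\<close>

definition turn :: "nat \<Rightarrow> nat \<Rightarrow> nat" where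
  "turn t m = (if m = 0 then 0 else if m = 1 then t + 3
     else if m < k then exit t m - r else exit t m - 1)"

definition phase :: "nat \<Rightarrow> nat \<Rightarrow> nat" where
  "phase t j = (LEAST m. j \<le> exit t m)"

lemma exit_0: "exit t 0 = t + 1"
  by (simp add: exit_def)

lemma exit_1: "exit t (Suc 0) = r + 2 + 2 * t"
  using k_ge by (simp add: exit_def)

lemma exit_k: "exit t k = n - r - 1 + t"
  using k_ge by (simp add: exit_def)

lemma exit_beyond: "k < m \<Longrightarrow> exit t m = n + m"
  by (simp add: exit_def)

lemma exit_mid: "1 \<le> m \<Longrightarrow> Suc m < k \<Longrightarrow> exit t (Suc m) = exit t m + (2 * r + 1)"
  by (cases m) (auto simp: exit_def algebra_simps)

text \<open>For inner exits the constant parts add up to \<open>4 * r + 6\<close>, and the remaining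
  \<open>k - 2\<close> periods of length \<open>2 * r + 1\<close> complete this to
  \<open>n + 1\<close>.\<close>

lemma exit_sym:
  assumes "t \<in> {1..r}" "m \<le> k"
  shows "exit t m + exit (r + 1 - t) (k - m) = n + 1"
proof -
  consider "m = 0" | "m = k" "m \<noteq> 0" | a c where "m = Suc a" "k = a + c + 2"
    using assms(2) by (metis Suc_eq_plus1 add.assoc add_Suc_right less_imp_Suc_add nat_less_le not0_implies_Suc one_add_one)
  then show ?thesis
  proof cases
    case 3
    then have "m \<noteq> 0" "m < k" "m - 1 = a" "k - m \<noteq> 0" "k - m < k" "k - m - 1 = c" by auto
    then have "exit t m = r + 2 + 2 * t + (2 * r + 1) * a"
      "exit (r + 1 - t) (k - m) = r + 2 + 2 * (r + 1 - t) + (2 * r + 1) * c"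
      unfolding exit_def by simp_all
    moreover have "n = (2 * r + 1) * (a + c + 2) + 3" using n_eq 3 by simp
    ultimately show ?thesis using assms(1) by (simp add: algebra_simps)
  qed (use assms n_ge k_ge in \<open>auto simp: exit_def\<close>)
qed

text \<open>Mirror image of the distance between the exits \<open>0\<close> and \<open>1\<close> of
  the letter \<open>r + 1 - t\<close>.\<close>

lemma exit_last:
  assumes "t \<in> {1..r}"
  shows "exit t k + t = exit t (k - 1) + 2 * r + 2"
proof -
  have t: "r + 1 - t \<in> {1..r}" "r + 1 - (r + 1 - t) = t" using assms by auto
  have "(r + 1 - t) + 1 + exit t k = n + 1"
    using exit_sym[OF t(1), of 0] t(2) by (simp add: exit_0)
  moreover have "r + 2 + 2 * (r + 1 - t) + exit t (k - 1) = n + 1"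
    using exit_sym[OF t(1), of 1] t(2) k_ge by (simp add: exit_1)
  ultimately show ?thesis using assms by auto
qed

lemma exit_less_Suc:
  assumes "t \<in> {1..r}"
  shows "exit t m < exit t (Suc m)"
proof -
  consider "m = 0" | "1 \<le> m" "Suc m < k" | "Suc m = k" | "m = k" | "k < m"
    by linarith
  then show ?thesis
  proof cases
    case 3
    then have "m = k - 1" by simp
    then show ?thesis using exit_last[OF assms] 3 assms by auto
  qed (use assms k_ge n_ge in \<open>auto simp: exit_0 exit_1 exit_mid exit_k exit_beyond\<close>)
qed

lemma exit_strict_mono: "t \<in> {1..r} \<Longrightarrow> strict_mono (exit t)"
  by (simp add: exit_less_Suc strict_mono_Suc_iff)

lemma exit_mid_bounds:
  assumes "t \<in> {1..r}" "1 \<le> m" "m < k"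
  shows "r + 2 + 2 * t \<le> exit t m" "exit t m + r + 3 \<le> n"
proof -
  have *: "r + 2 + 2 * t \<le> exit t m" if "1 \<le> m" "m < k" for t m
    using that by (simp add: exit_def)
  then show "r + 2 + 2 * t \<le> exit t m" using assms by blast
  \<comment> \<open>The upper bound is the lower bound for the mirrored exit.\<close>
  have "r + 2 + 2 * (r + 1 - t) \<le> exit (r + 1 - t) (k - m)"
    using assms by (intro *) auto
  then show "exit t m + r + 3 \<le> n" using exit_sym[of t m] assms by auto
qed

text \<open>The dummy exits are unbounded, so the minimum in \<open>phase\<close> exists for every
  \<open>j\<close>.\<close>

lemma phase_le: "j \<le> exit t (phase t j)"
proof -
  have "j \<le> exit t (Suc (k + j))" by (simp add: exit_beyond)
  then show ?thesis unfolding phase_def by (rule LeastI)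
qed

lemma phase_gt: "m < phase t j \<Longrightarrow> exit t m < j"
  unfolding phase_def using not_less_Least by (meson not_le_imp_less)

lemma phase_eqI:
  assumes "t \<in> {1..r}" "j \<le> exit t m" "m > 0 \<Longrightarrow> exit t (m - 1) < j"
  shows "phase t j = m"
  unfolding phase_def
proof (rule Least_equality)
  show "m \<le> y" if "j \<le> exit t y" for y
  proof (rule ccontr)
    assume "\<not> m \<le> y"
    then have "m > 0" "y \<le> m - 1" by auto
    then have "exit t y \<le> exit t (m - 1)"
      using exit_strict_mono[OF assms(1)] by (simp add: strict_mono_less_eq)
    then show False using assms(3) \<open>m > 0\<close> that by simp
  qed
qed (use assms in auto)

lemma exit_less_turn:
  assumes "t \<in> {1..r}" "m \<le> k"
  shows "exit t m < turn t (Suc m)"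
proof -
  consider "m = 0" | "1 \<le> m" "Suc m < k" | "Suc m = k" "1 \<le> m" | "m = k"
    using assms(2) by linarith
  then show ?thesis
  proof cases
    case 3
    then have "m = k - 1" by simp
    then show ?thesis using exit_last[OF assms(1)] 3 assms by (auto simp: turn_def)
  qed (use assms k_ge n_ge in \<open>auto simp: turn_def exit_0 exit_mid exit_k exit_beyond\<close>)
qed

lemma exit_pred_less_turn:
  assumes "t \<in> {1..r}" "0 < m" "m \<le> Suc k"
  shows "exit t (m - 1) < turn t m"
  using exit_less_turn[OF assms(1), of "m - 1"] assms(2,3) by (cases m) auto

lemma turn_less_exit:
  assumes "t \<in> {1..r}"
  shows "turn t m < exit t m"
proof -
  consider "m = 0" | "m = 1" | "2 \<le> m" "m < k" | "k \<le> m" "2 \<le> m"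
    using k_ge by linarith
  then show ?thesis
  proof cases
    case 3
    then show ?thesis using exit_mid_bounds[of t m] assms by (auto simp: turn_def)
  next
    case 4
    then show ?thesis using assms n_ge by (cases "m = k") (auto simp: turn_def exit_k exit_beyond)
  qed (use assms in \<open>auto simp: turn_def exit_0 exit_1\<close>)
qed

text \<open>The sum is \<open>n + 2\<close>, not \<open>n + 1\<close>: the mirror of the first block
  with the letter at the end is the last one with the mirrored letter at the beginning.\<close>

lemma turn_sym:
  assumes "t \<in> {1..r}" "1 \<le> m" "m \<le> k"
  shows "turn t m + turn (r + 1 - t) (k + 1 - m) = n + 2"
proof -
  consider "m = 1" | "m = k" "m \<noteq> 1" | "2 \<le> m" "m < k"
    using assms by linarith
  then show ?thesis
  proof cases
    case 3
    obtain m' where m': "m = Suc m'" using 3 by (cases m) auto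
    then have "exit t m' + exit (r + 1 - t) (k - m') = n + 1"
      using exit_sym[of t m'] assms by auto
    moreover have "exit t m = exit t m' + (2 * r + 1)"
      using exit_mid[of m' t] 3 m' by auto
    moreover have "r \<le> exit (r + 1 - t) (k - m')"
    proof -
      have "r + 1 - t \<in> {1..r}" "1 \<le> k - m'" "k - m' < k" using 3 m' assms by auto
      from exit_mid_bounds(1)[OF this] show ?thesis by simp
    qed
    moreover have "turn t m = exit t m - r" "turn (r + 1 - t) (k + 1 - m) = exit (r + 1 - t) (k - m') - r"
      using 3 m' by (auto simp: turn_def)
    ultimately show ?thesis by linarith
  qed (use assms n_ge k_ge in \<open>auto simp: turn_def exit_k\<close>)
qed

section \<open>Contents, order and levels of the blocks\<close>

definition letters :: "nat set" where
  "letters = {1..r} \<union> {r + 2..n + 1}"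

text \<open>Blocks \<open>2, ..., r + 1\<close> and \<open>n - r, ..., n - 1\<close> miss one skip
  letter each (exits \<open>0\<close> and \<open>k\<close>), blocks \<open>1\<close> and
  \<open>n\<close> miss nothing, and a block \<open>j\<close> in between misses the letter
  \<open>j\<close> and at most one skip letter.\<close>

definition absent :: "nat \<Rightarrow> nat \<Rightarrow> bool" where
  "absent j a \<longleftrightarrow> (if a \<le> r then j = exit a (phase a j) else a < n - r \<and> j = a)"

definition present :: "nat \<Rightarrow> nat set" where
  "present j = {a \<in> letters. \<not> absent j a}"

text \<open>
  Blocks are sorted by \<open>key\<close>: letters on their way out stand at the end, the sooner they are missing the
  later; letters that were missing stand at the beginning, the more recently the earlier. Next to
  a block that misses two letters, the summand \<open>of_bool\<close> puts the skip letter farther from that block.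
\<close>
definition key :: "nat \<Rightarrow> nat \<Rightarrow> int" where
  "key j a =
     (if a \<le> r then
        (let m = phase a j in
         if turn a m \<le> j then 6 * int n + 4 - 2 * int (exit a m) - of_bool (1 \<le> m \<and> m < k)
         else of_bool (1 \<le> m - 1 \<and> m - 1 < k) - 2 * int (exit a (m - 1)))
      else if a < n - r then (if j < a then 6 * int n + 4 - 2 * int a else - 2 * int a)
      else 2 * int n + 1)"

text \<open>For a letter next missing from block \<open>b\<close> this is the bound
  \<open>b - 1 - j\<close>, except that \<open>b \<le> r + 1\<close> gives \<open>r - j\<close>:
  there the \<open>j\<close> letters read are all skip letters. The value \<open>r\<close> is the
  trivial bound.\<close>

definition level :: "nat \<Rightarrow> nat \<Rightarrow> nat" where
  "level j a =
     (if a \<le> r then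
        (let m = phase a j in if turn a m \<le> j \<and> m < k then max (r + 1) (exit a m) - 1 - j else r)
      else if j < a \<and> a < n - r then a - 1 - j else r)"

text \<open>Letter \<open>a\<close> stands at the end of block \<open>j\<close>, and \<open>b\<close> is the next block that misses it; the blocks
  \<open>exit a k\<close> are left out because all blocks missing two letters come before them.\<close>
definition due :: "nat \<Rightarrow> nat \<Rightarrow> nat \<Rightarrow> bool" where
  "due j a b \<longleftrightarrow>
     a \<in> {1..r} \<and> (let m = phase a j in m < k \<and> turn a m \<le> j \<and> j < exit a m \<and> b = exit a m) \<or>
     a \<in> {r + 2..<n - r} \<and> j < a \<and> b = a"

lemma due_less: "due j a b \<Longrightarrow> j < b"
  by (auto simp: due_def Let_def)

lemma due_bound:
  assumes "due j a b"
  shows "b < n - r"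
proof (cases "a \<le> r")
  case True
  then have "a \<in> {1..r}" "phase a j < k" "b = exit a (phase a j)"
    using assms by (auto simp: due_def Let_def)
  then show ?thesis
    using exit_mid_bounds(2)[of a "phase a j"] n_ge by (cases "phase a j = 0") (auto simp: exit_0)
qed (use assms in \<open>auto simp: due_def\<close>)

lemma due_level: "due j a b \<Longrightarrow> level j a = max (r + 1) b - 1 - j"
  by (auto simp: due_def level_def Let_def)

lemma not_due_level:
  assumes "a \<in> present j" "\<nexists>b. due j a b"
  shows "level j a = r"
  using assms phase_le[of j a]
  by (auto simp: due_def level_def Let_def present_def absent_def letters_def le_neq_implies_less)

lemma due_key:
  assumes "due j a b"
  shows "key j a \<le> 6 * int n + 4 - 2 * int b" "key j a \<ge> 6 * int n + 3 - 2 * int b"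
    "a > r \<or> b \<le> r + 1 \<Longrightarrow> key j a = 6 * int n + 4 - 2 * int b"
    "a \<le> r \<Longrightarrow> b > r + 1 \<Longrightarrow> key j a = 6 * int n + 3 - 2 * int b"
proof -
  have m: "phase a j = 0 \<longleftrightarrow> b \<le> r + 1" if "a \<le> r"
  proof (cases "phase a j = 0")
    case True
    then show ?thesis using assms that by (auto simp: due_def Let_def exit_0)
  next
    case False
    then show ?thesis using assms that exit_mid_bounds(1)[of a "phase a j"]
      by (auto simp: due_def Let_def)
  qed
  show "key j a \<le> 6 * int n + 4 - 2 * int b" "key j a \<ge> 6 * int n + 3 - 2 * int b"
    "a > r \<or> b \<le> r + 1 \<Longrightarrow> key j a = 6 * int n + 4 - 2 * int b"
    "a \<le> r \<Longrightarrow> b > r + 1 \<Longrightarrow> key j a = 6 * int n + 3 - 2 * int b"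
    using assms m by (auto simp: due_def key_def Let_def)
qed

text \<open>The value \<open>4 * n + 2\<close> separates the letters at the end from all others,
  whose keys are at most \<open>2 * n + 1\<close>.\<close>

lemma key_ge_imp:
  assumes "a \<in> present j" "key j a \<ge> 4 * int n + 2" "j \<le> n"
  shows "(\<exists>b. due j a b) \<or>
    a \<in> {1..r} \<and> phase a j = k \<and> j < exit a k \<and> key j a = 6 * int n + 4 - 2 * int (exit a k)"
proof (cases "a \<le> r")
  case True
  then have a: "a \<in> {1..r}" and less: "j < exit a (phase a j)"
    using assms(1) phase_le[of j a] by (auto simp: present_def absent_def letters_def)
  have turn: "turn a (phase a j) \<le> j"
  proof (rule ccontr)
    assume "\<not> ?thesis"
    then have "key j a \<le> 1" using True by (auto simp: key_def Let_def)
    then show False using assms by simp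
  qed
  have "phase a j \<le> k"
  proof (rule ccontr)
    assume "\<not> ?thesis"
    then have "turn a (phase a j) = n + phase a j - 1" using k_ge by (auto simp: turn_def exit_beyond)
    then show False using turn assms(3) \<open>\<not> phase a j \<le> k\<close> k_ge by simp
  qed
  then show ?thesis using a less turn True k_ge
    by (cases "phase a j = k") (auto simp: due_def key_def Let_def)
next
  case False
  then have "a \<le> n + 1" "r + 2 \<le> a" using assms(1) by (auto simp: present_def letters_def)
  then show ?thesis using assms False by (auto simp: due_def key_def split: if_splits)
qed

text \<open>At the end of a block keys fall as the next missing block grows, and last exits come
  after \<open>b\<close>. A tie \<open>b' = b\<close> pairs a skip letter with the letter
  \<open>b\<close>; there the \<open>of_bool\<close> in \<open>key\<close> puts the skip letter
  first.\<close>

lemma due_follow: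
  assumes "due j a b" "a' \<in> present j" "key j a \<le> key j a'" "j \<le> n" "a \<noteq> a'"
  obtains b' where "due j a' b'" "b' \<le> b" "a > r \<Longrightarrow> b' < b"
proof -
  have b: "b < n - r" using due_bound[OF assms(1)] .
  have key: "key j a' \<ge> 6 * int n + 3 - 2 * int b" using due_key(2)[OF assms(1)] assms(3) by simp
  then have "key j a' \<ge> 4 * int n + 2" using b by simp
  from key_ge_imp[OF assms(2) this assms(4)] obtain b' where b': "due j a' b'"
  proof (elim disjE exE conjE)
    assume "a' \<in> {1..r}" "key j a' = 6 * int n + 4 - 2 * int (exit a' k)"
    then show ?thesis using key b n_ge by (auto simp: exit_k)
  qed
  have le: "b' \<le> b" using due_key(1)[OF b'] key by simp
  moreover have "b' < b" if "a > r"
  proof (rule ccontr)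
    assume "\<not> b' < b"
    then have eq: "b' = b" using le by simp
    have "a = b" "b \<ge> r + 2" using assms(1) that by (auto simp: due_def)
    then have "a' > r" using due_key(3)[OF assms(1)] due_key(4)[OF b'] assms(3) eq that by fastforce
    then have "a' = b'" using b' by (auto simp: due_def)
    then show False using eq \<open>a = b\<close> assms(5) by simp
  qed
  ultimately show ?thesis using that b' by blast
qed

section \<open>Verification of the level conditions\<close>

lemma phase_0_eq: "a \<in> {1..r} \<Longrightarrow> j \<le> a + 1 \<Longrightarrow> phase a j = 0"
  by (rule phase_eqI) (auto simp: exit_0)

lemma present_1: "present 1 = letters"
  using phase_0_eq[of _ 1] by (auto simp: present_def absent_def letters_def exit_0)

lemma level_first:
  assumes "a \<in> letters"
  shows "r \<le> level 1 a + of_bool (a \<in> {1..r})"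
  using assms phase_0_eq[of a 1] k_ge
  by (auto simp: letters_def level_def exit_0 turn_def Let_def)

text \<open>A skip letter turning exactly in block \<open>Suc j\<close> has its exit at least
  \<open>r\<close> blocks later, so its level is at least \<open>r - 1\<close> and the trivial bound
  applies.\<close>

lemma due_pred:
  assumes "due (Suc j) a b"
  shows "r \<le> level (Suc j) a + of_bool (a \<in> {1..r}) \<or> due j a b \<and> a \<in> present j"
proof (cases "a \<le> r")
  case True
  define m where "m = phase a (Suc j)"
  have a: "a \<in> {1..r}" and m: "m < k" "turn a m \<le> Suc j" "Suc j < exit a m" "b = exit a m"
    using assms True by (auto simp: due_def m_def Let_def)
  show ?thesis
  proof (cases "turn a m \<le> j")
    case True
    have "m > 0 \<Longrightarrow> exit a (m - 1) < j"
      using exit_pred_less_turn[OF a, of m] m(1) True by simp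
    then have "phase a j = m" using m a by (intro phase_eqI) auto
    then show ?thesis using a m True by (auto simp: due_def present_def letters_def absent_def Let_def)
  next
    case False
    then have eq: "turn a m = Suc j" using m(2) by linarith
    have "m > 0" using False by (cases m) (auto simp: turn_def)
    have "r - 1 \<le> max (r + 1) b - 1 - Suc j"
    proof (cases "m = 1")
      case True
      then show ?thesis using eq a m by (auto simp: turn_def exit_1)
    next
      case False
      then have "Suc j = b - r" using eq m \<open>m > 0\<close> by (auto simp: turn_def)
      then show ?thesis using m by simp
    qed
    then show ?thesis using due_level[OF assms] a by auto
  qed
next
  case False
  then show ?thesis using assms by (auto simp: due_def present_def letters_def absent_def)
qed

text \<open>One block further, \<open>b - 1 - j\<close> drops by one. For a skip letter
  \<open>of_bool\<close> makes up for this, for any other letter the strict inequality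
  \<open>b' < b\<close> does.\<close>

lemma level_step:
  assumes "j < n" "a \<in> present (Suc j)"
  shows "r \<le> level (Suc j) a + of_bool (a \<in> {1..r}) \<or>
    a \<in> present j \<and> (\<forall>a'\<in>present j. key j a \<le> key j a' \<longrightarrow> a \<noteq> a' \<longrightarrow>
      level j a' \<le> level (Suc j) a + of_bool (a \<in> {1..r}))"
proof (cases "r \<le> level (Suc j) a + of_bool (a \<in> {1..r})")
  case False
  then obtain b where b: "due (Suc j) a b" using not_due_level[OF assms(2)] by auto
  then have bj: "due j a b" "a \<in> present j" using due_pred False by auto
  have "level j a' \<le> level (Suc j) a + of_bool (a \<in> {1..r})"
    if a': "a' \<in> present j" "key j a \<le> key j a'" "a \<noteq> a'" for a'
  proof -
    obtain b' where b': "due j a' b'" "b' \<le> b" "a > r \<Longrightarrow> b' < b"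
      using due_follow[OF bj(1) a'(1,2) _ a'(3)] assms(1) by auto
    have "a > r \<Longrightarrow> b \<ge> r + 2" using bj(1) by (auto simp: due_def)
    moreover have "a \<in> {1..r} \<or> a > r" using bj by (auto simp: present_def letters_def)
    ultimately show ?thesis
      using due_level[OF b'(1)] due_level[OF b] due_less[OF b] b'(2,3) by auto
  qed
  then show ?thesis using bj by blast
qed simp

lemma absent_due_or_last:
  assumes "1 \<le> j" "j < n" "a \<in> letters" "absent (Suc j) a"
  shows "due j a (Suc j) \<or> a \<in> {1..r} \<and> Suc j = exit a k \<and> phase a j = k \<and> turn a k \<le> j"
proof (cases "a \<le> r")
  case True
  define m where "m = phase a (Suc j)"
  have a: "a \<in> {1..r}" and m: "Suc j = exit a m"
    using assms True by (auto simp: letters_def absent_def m_def)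
  have mk: "m \<le> k"
  proof (rule ccontr)
    assume "\<not> ?thesis"
    then show False using m assms(2) k_ge by (simp add: exit_beyond)
  qed
  have turn: "turn a m \<le> j" using turn_less_exit[OF a, of m] m by simp
  have "m > 0 \<Longrightarrow> exit a (m - 1) < j"
    using exit_pred_less_turn[OF a, of m] mk turn by simp
  then have "phase a j = m" using m a by (intro phase_eqI) auto
  then show ?thesis using a m mk turn by (cases "m = k") (auto simp: due_def Let_def)
next
  case False
  then show ?thesis using assms by (auto simp: letters_def absent_def due_def)
qed

lemma due_present: "due j a b \<Longrightarrow> a \<in> present j"
  using due_less[of j a b] n_ge by (auto simp: due_def present_def absent_def letters_def Let_def)

text \<open>A letter \<open>a'\<close> behind \<open>a\<close> must be due at \<open>Suc j\<close>
  as well, so \<open>a\<close> is a skip letter and the level of \<open>a'\<close> is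
  \<open>Suc j - 1 - j = 0\<close>. Behind a letter at its last exit there is nothing.\<close>

lemma absent_step:
  assumes "1 \<le> j" "j < n" "a \<in> letters" "absent (Suc j) a"
  shows "a \<in> present j \<and> (\<forall>a'\<in>present j. key j a \<le> key j a' \<longrightarrow> a \<noteq> a' \<longrightarrow>
      a \<in> {1..r} \<and> level j a' = 0)"
  using absent_due_or_last[OF assms]
proof (elim disjE conjE)
  assume due: "due j a (Suc j)"
  have "a \<in> {1..r} \<and> level j a' = 0"
    if a': "a' \<in> present j" "key j a \<le> key j a'" "a \<noteq> a'" for a'
  proof -
    obtain b' where b': "due j a' b'" "b' \<le> Suc j" "a > r \<Longrightarrow> b' < Suc j"
      using due_follow[OF due a'(1,2) _ a'(3)] assms(2) by auto
    then have eq: "b' = Suc j" and ar: "a \<in> {1..r}"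
      using due_less[OF b'(1)] assms(3) by (auto simp: letters_def)
    have "r + 1 \<le> Suc j"
    proof (rule ccontr)
      assume small: "\<not> ?thesis"
      \<comment> \<open>A block \<open>Suc j\<close> before block \<open>r + 1\<close> misses only
        the skip letter \<open>j\<close>, so two letters cannot compete there.\<close>
      have "x = j" if x: "due j x (Suc j)" for x
      proof -
        have xr: "x \<in> {1..r}" using x small by (auto simp: due_def)
        have "phase x j = 0"
          using exit_mid_bounds(1)[OF xr, of "phase x j"] x xr small
          by (cases "phase x j = 0") (auto simp: due_def Let_def)
        then show ?thesis using x xr by (auto simp: due_def Let_def exit_0)
      qed
      then show False using due b'(1) a'(3) eq by blast
    qed
    then show ?thesis using due_level[OF b'(1)] eq ar by simp
  qed
  then show ?thesis using due_present[OF due] by blast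
next
  assume a: "a \<in> {1..r}" "Suc j = exit a k" "phase a j = k" "turn a k \<le> j"
  have key: "key j a = 6 * int n + 4 - 2 * int (Suc j)" using a by (simp add: key_def)
  \<comment> \<open>A rival would be due in a block before \<open>n - r\<close>, hence before
    \<open>exit a k\<close>, or share the last exit, which determines the letter.\<close>
  have "a' = a" if a': "a' \<in> present j" "key j a \<le> key j a'" for a'
  proof -
    have "key j a' \<ge> 4 * int n + 2" using key a'(2) assms(2) by simp
    from key_ge_imp[OF a'(1) this] assms(2)
    consider b where "due j a' b" | "a' \<in> {1..r}" "j < exit a' k" "key j a' = 6 * int n + 4 - 2 * int (exit a' k)"
      by auto
    then show ?thesis
    proof cases
      case 1
      then have "b \<le> Suc j" using due_key(1)[OF 1] key a'(2) by simp
      then have "exit a k < n - r" using due_bound[OF 1] due_less[OF 1] a(2) by simp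
      moreover have "1 \<le> a" "r + 1 \<le> n" using a(1) n_ge by auto
      ultimately show ?thesis unfolding exit_k by linarith
    next
      case 2
      then have "exit a' k = exit a k" using key a'(2) a(2) by simp
      then show ?thesis by (simp add: exit_k)
    qed
  qed
  moreover have "a \<in> present j" using a by (auto simp: present_def letters_def absent_def)
  ultimately show ?thesis by blast
qed

text \<open>Kept general in \<open>B\<close> to cover both \<open>block\<close> and its reversed and
  renamed version.\<close>

lemma levelled_blocks_sorted:
  assumes set: "\<And>j. j \<in> {1..n} \<Longrightarrow> set (B j) = present j"
    and distinct: "\<And>j. j \<in> {1..n} \<Longrightarrow> distinct (B j)"
    and sorted: "\<And>j. j \<in> {1..n} \<Longrightarrow> sorted (map (key j) (B j))"
  shows "levelled_blocks B letters {1..r} level n"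
proof
  have n: "1 \<in> {1..n}" using n_ge by simp
  show "set (B 1) = letters" using set[OF n] present_1 by simp
  show "card {1..r} \<le> level 1 a + of_bool (a \<in> {1..r})" if "a \<in> letters" for a
    using level_first[OF that] by simp
next
  fix j a assume *: "1 \<le> j" "j < n" "a \<in> set (B (Suc j))"
  then have j: "j \<in> {1..n}" "a \<in> present (Suc j)" using set by auto
  have "b \<in> present j \<and> key j a \<le> key j b \<and> a \<noteq> b" if "follows (B j) a b" for b
    using follows_sorted[OF sorted distinct that] follows_in_set[OF that] set j by auto
  then show "card {1..r} \<le> level (Suc j) a + of_bool (a \<in> {1..r}) \<or>
      a \<in> set (B j) \<and> (\<forall>b. follows (B j) a b \<longrightarrow> level j b \<le> level (Suc j) a + of_bool (a \<in> {1..r}))"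
    using level_step[OF *(2) j(2)] set[OF j(1)] by (metis card_atLeastAtMost diff_Suc_1)
next
  fix j a assume *: "1 \<le> j" "j < n" "a \<in> letters" "a \<notin> set (B (Suc j))"
  then have j: "j \<in> {1..n}" "absent (Suc j) a" using set by (auto simp: present_def)
  have "b \<in> present j \<and> key j a \<le> key j b \<and> a \<noteq> b" if "follows (B j) a b" for b
    using follows_sorted[OF sorted distinct that] follows_in_set[OF that] set j by auto
  then show "a \<in> set (B j) \<and> (\<forall>b. follows (B j) a b \<longrightarrow> a \<in> {1..r} \<and> level j b = 0)"
    using absent_step[OF *(1-3) j(2)] set[OF j(1)] by metis
qed simp

section \<open>Mirror symmetry\<close>

text \<open>
  Reversing the sequence of blocks amounts to renaming the letters by \<open>mirror\<close>, so one application of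
  \<open>levelled_blocks\<close> to each of the two sequences suffices.
\<close>
definition mirror :: "nat \<Rightarrow> nat" where
  "mirror a = (if a \<le> r then r + 1 - a else if a < n - r then n + 1 - a else a)"

lemma mirror_letters: "a \<in> letters \<Longrightarrow> mirror a \<in> letters"
  using n_ge by (auto simp: mirror_def letters_def)

lemma mirror_mirror: "a \<in> letters \<Longrightarrow> mirror (mirror a) = a"
  using n_ge by (auto simp: mirror_def letters_def)

text \<open>By \<open>exit_sym\<close> the exits \<open>m - 1\<close> and \<open>m\<close> around
  block \<open>j\<close> become the exits \<open>k + 1 - m\<close> and \<open>k - m\<close> around
  block \<open>n + 1 - j\<close>. Phase \<open>0\<close> corresponds to the dummy phase
  \<open>k + 1\<close>.\<close>

lemma phase_mirror:
  assumes "t \<in> {1..r}" "j \<in> {1..n}" "\<not> absent j t"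
  shows "phase (r + 1 - t) (n + 1 - j) = k + 1 - phase t j" "phase t j \<le> k + 1"
    "\<not> absent (n + 1 - j) (r + 1 - t)"
    "turn (r + 1 - t) (k + 1 - phase t j) \<le> n + 1 - j \<longleftrightarrow> j < turn t (phase t j)"
proof -
  define m where "m = phase t j"
  let ?t = "r + 1 - t" and ?j = "n + 1 - j"
  have t': "?t \<in> {1..r}" using assms(1) by auto
  have m: "j < exit t m" "m > 0 \<Longrightarrow> exit t (m - 1) < j"
    using assms phase_le[of j t] phase_gt[of "m - 1" t j] by (auto simp: absent_def m_def)
  have mk: "m \<le> k + 1"
  proof (rule ccontr)
    assume "\<not> ?thesis"
    then have "exit t (m - 1) = n + (m - 1)" by (simp add: exit_beyond)
    then show False using m(2) \<open>\<not> m \<le> k + 1\<close> assms(2) by auto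
  qed
  then show "phase t j \<le> k + 1" by (simp add: m_def)
  have up: "?j < exit ?t (k + 1 - m)"
  proof (cases "m = 0")
    case True
    then show ?thesis using assms(2) k_ge by (simp add: exit_beyond)
  next
    case False
    then have "m - 1 \<le> k" "k - (m - 1) = k + 1 - m" using mk by auto
    then show ?thesis using exit_sym[OF assms(1), of "m - 1"] m(2) False assms(2) by auto
  qed
  have low: "exit ?t (k - m) < ?j" if "m \<le> k"
    using exit_sym[OF assms(1) that] m(1) assms(2) by auto
  show ph: "phase ?t ?j = k + 1 - phase t j"
    unfolding m_def[symmetric] using up low mk by (intro phase_eqI[OF t']) auto
  show "\<not> absent ?j ?t" using ph up assms(1) by (auto simp: absent_def m_def)
  show "turn ?t (k + 1 - phase t j) \<le> ?j \<longleftrightarrow> j < turn t (phase t j)"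
    unfolding m_def[symmetric]
  proof -
    consider "m = 0" | "m = k + 1" | "1 \<le> m" "m \<le> k" using mk by linarith
    then show "turn ?t (k + 1 - m) \<le> ?j \<longleftrightarrow> j < turn t m"
    proof cases
      case 3
      then show ?thesis using turn_sym[OF assms(1), of m] assms(2) by auto
    qed (use assms(2) k_ge in \<open>auto simp: turn_def exit_beyond\<close>)
  qed
qed

lemma present_mirror:
  assumes "j \<in> {1..n}" "a \<in> present j"
  shows "mirror a \<in> present (n + 1 - j)"
proof (cases "a \<le> r")
  case True
  then show ?thesis using phase_mirror(3)[of a j] assms mirror_letters[of a]
    by (auto simp: present_def mirror_def letters_def)
next
  case False
  then show ?thesis using assms mirror_letters[of a] n_ge
    by (auto simp: present_def mirror_def letters_def absent_def)
qed

text \<open>Reflection at \<open>2 * n + 1\<close>, the key of the letters that are never missing,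
  takes \<open>6 * n + 4 - 2 * e\<close> to \<open>-2 * (n + 1 - e)\<close>, and
  \<open>n + 1 - e\<close> is the mirrored exit.\<close>

lemma key_mirror:
  assumes "j \<in> {1..n}" "a \<in> present j"
  shows "key (n + 1 - j) (mirror a) = 4 * int n + 2 - key j a"
proof (cases "a \<le> r")
  case True
  define m where "m = phase a j"
  let ?t = "r + 1 - a" and ?j = "n + 1 - j"
  have a: "a \<in> {1..r}" "\<not> absent j a" using assms(2) True by (auto simp: present_def letters_def)
  note ph = phase_mirror[OF a(1) assms(1) a(2), folded m_def]
  have mir: "mirror a = ?t" "?t \<le> r" using a by (auto simp: mirror_def)
  show ?thesis
  proof (cases "turn a m \<le> j")
    case True
    have mk: "m \<le> k"
    proof (rule ccontr)
      assume "\<not> ?thesis"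
      then show False using ph(2) True assms(1) k_ge by (auto simp: turn_def exit_beyond)
    qed
    have "int (exit a m) + int (exit ?t (k - m)) = int n + 1" using exit_sym[OF a(1) mk] by linarith
    moreover have "key ?j ?t = of_bool (1 \<le> k - m \<and> k - m < k) - 2 * int (exit ?t (k - m))"
      using ph(1,4) True mir by (simp add: key_def Let_def)
    moreover have "key j a = 6 * int n + 4 - 2 * int (exit a m) - of_bool (1 \<le> m \<and> m < k)"
      using True a by (simp add: key_def Let_def m_def)
    moreover have "(1 \<le> k - m \<and> k - m < k) = (1 \<le> m \<and> m < k)" using mk by auto
    ultimately show ?thesis using mir by simp
  next
    case False
    have m0: "m > 0" using False by (cases m) (auto simp: turn_def)
    have mk: "m - 1 \<le> k" "k - (m - 1) = k + 1 - m" using ph(2) m0 by auto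
    have "int (exit a (m - 1)) + int (exit ?t (k + 1 - m)) = int n + 1"
      using exit_sym[OF a(1) mk(1)] mk(2) by simp
    moreover have "key ?j ?t = 6 * int n + 4 - 2 * int (exit ?t (k + 1 - m)) - of_bool (1 \<le> k + 1 - m \<and> k + 1 - m < k)"
      using ph(1,4) False mir by (simp add: key_def Let_def)
    moreover have "key j a = of_bool (1 \<le> m - 1 \<and> m - 1 < k) - 2 * int (exit a (m - 1))"
      using False a by (simp add: key_def Let_def m_def)
    moreover have "(1 \<le> k + 1 - m \<and> k + 1 - m < k) = (1 \<le> m - 1 \<and> m - 1 < k)" using mk m0 by auto
    ultimately show ?thesis using mir by simp
  qed
next
  case False
  then show ?thesis using assms n_ge
    by (auto simp: present_def mirror_def letters_def absent_def key_def)
qed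

section \<open>Reading lists from the left and from the right\<close>

definition block :: "nat \<Rightarrow> nat list" where
  "block j = sort_key (key j) (sorted_list_of_set (present j))"

lemma finite_letters: "finite letters"
  by (simp add: letters_def)

lemma set_block: "set (block j) = present j"
  using finite_letters by (simp add: block_def present_def)

lemma distinct_block: "distinct (block j)"
  by (simp add: block_def)

lemma card_letters: "card letters = n"
  using n_ge by (simp add: letters_def card_Un_disjoint)

lemma block_fits_left:
  assumes "distinct p" "set p \<subseteq> letters"
  shows "subseq p (concat (map block [1..<Suc (length p)]))"
proof -
  interpret levelled_blocks block letters "{1..r}" level n
    by (rule levelled_blocks_sorted) (simp_all add: set_block distinct_block, simp add: block_def)
  have "length p \<le> n" using assms card_letters finite_letters by (metis card_mono distinct_card)
  then show ?thesis using subseq_word_upto[OF assms] by (simp only: word_upto_conv_concat)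
qed

lemma block_fits_right:
  assumes "distinct p" "set p \<subseteq> letters"
  shows "subseq p (concat (map block [Suc (n - length p)..<Suc n]))"
proof -
  \<comment> \<open>Reversing a block reverses the order of its keys and \<open>key_mirror\<close>
    reflects them, so the renamed block is sorted again.\<close>
  define B where "B j = map mirror (rev (block (Suc n - j)))" for j
  then have B: "B = (\<lambda>j. map mirror (rev (block (Suc n - j))))" by blast
  have inj: "inj_on mirror letters" by (metis inj_onI mirror_mirror)
  have pres: "mirror ` present (n + 1 - j) = present j" if "j \<in> {1..n}" for j
  proof -
    have j': "n + 1 - j \<in> {1..n}" "n + 1 - (n + 1 - j) = j" using that by auto
    show ?thesis
    proof
      show "mirror ` present (n + 1 - j) \<subseteq> present j"
        using present_mirror[OF j'(1)] j'(2) by auto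
      show "present j \<subseteq> mirror ` present (n + 1 - j)"
      proof
        fix a assume "a \<in> present j"
        then have "mirror a \<in> present (n + 1 - j)" "a = mirror (mirror a)"
          using present_mirror[OF that] mirror_mirror by (auto simp: present_def)
        then show "a \<in> mirror ` present (n + 1 - j)" by blast
      qed
    qed
  qed
  interpret levelled_blocks B letters "{1..r}" level n
  proof (rule levelled_blocks_sorted)
    fix j assume j: "j \<in> {1..n}"
    then have j': "n + 1 - j \<in> {1..n}" "n + 1 - (n + 1 - j) = j" by auto
    show "set (B j) = present j" using pres[OF j] by (simp add: B_def set_block)
    have "inj_on mirror (present i)" for i using inj by (rule inj_on_subset) (auto simp: present_def)
    then show "distinct (B j)" by (simp add: B_def distinct_map set_block distinct_block)
    have "map (key j) (B j) = rev (map (\<lambda>a. key j (mirror a)) (block (n + 1 - j)))"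
      by (simp add: B_def rev_map)
    also have "\<dots> = rev (map (\<lambda>a. 4 * int n + 2 - key (n + 1 - j) a) (block (n + 1 - j)))"
      using key_mirror[OF j'(1)] j'(2) by (simp add: set_block)
    also have "sorted \<dots>"
      using sorted_sort_key[of "key (n + 1 - j)"]
      by (simp add: block_def sorted_wrt_rev sorted_wrt_map)
    finally show "sorted (map (key j) (B j))" .
  qed
  let ?p = "map mirror (rev p)"
  have p: "distinct ?p" "set ?p \<subseteq> letters" 
    using assms mirror_letters inj by (auto simp: distinct_map intro: inj_on_subset)
  have len: "length p \<le> n" using assms card_letters finite_letters by (metis card_mono distinct_card)
  have "word_upto B (length p) = map mirror (word_upto (\<lambda>j. rev (block (Suc n - j))) (length p))"
    by (simp only: B word_upto_conv_concat map_concat map_map o_def)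
  also have "\<dots> = map mirror (rev (concat (map block [Suc (n - length p)..<Suc n])))"
    by (simp only: word_upto_rev[OF len])
  finally have "subseq ?p (map mirror (rev (concat (map block [Suc (n - length p)..<Suc n]))))"
    using subseq_word_upto[OF p] len by simp
  \<comment> \<open>\<open>mirror\<close> is an involution on \<open>letters\<close>, so applying it
    again removes the renaming; only the reversal is left to undo.\<close>
  then have "subseq (map mirror ?p) (map mirror (map mirror (rev (concat (map block [Suc (n - length p)..<Suc n])))))"
    by (rule subseq_map)
  moreover have "map mirror (map mirror xs) = xs" if "set xs \<subseteq> letters" for xs
    using that mirror_mirror by (auto intro!: map_idI)
  moreover have "set (concat (map block js)) \<subseteq> letters" for js
    by (auto simp: set_block present_def)
  ultimately have "subseq (rev p) (rev (concat (map block [Suc (n - length p)..<Suc n])))"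
    using assms(2) by (metis set_rev)
  from subseq_rev[OF this] show ?thesis by (simp only: rev_rev_ident)
qed

section \<open>Length of the sequence\<close>

lemma phase_exit: "t \<in> {1..r} \<Longrightarrow> phase t (exit t m) = m"
  using exit_less_Suc[of t "m - 1"] by (intro phase_eqI) auto

lemma absent_skip_letter:
  assumes "a \<in> {1..r}"
  shows "{j \<in> {1..n}. absent j a} = exit a ` {..k}"
proof (intro equalityI subsetI)
  fix j assume "j \<in> {j \<in> {1..n}. absent j a}"
  then have j: "j \<le> n" "j = exit a (phase a j)" using assms by (auto simp: absent_def)
  have "phase a j \<le> k"
  proof (rule ccontr)
    assume "\<not> ?thesis"
    then show False using j exit_beyond[of "phase a j" a] by auto
  qed
  then show "j \<in> exit a ` {..k}" using j(2) by blast
next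
  fix j assume "j \<in> exit a ` {..k}"
  then obtain m where m: "m \<le> k" "j = exit a m" by auto
  have "exit a m \<le> exit a k" "exit a 0 \<le> exit a m"
    using exit_strict_mono[OF assms] m(1) by (simp_all add: strict_mono_less_eq)
  then have "1 \<le> j" "j \<le> n" using assms n_ge by (auto simp: m(2) exit_0 exit_k)
  moreover have "absent j a" using assms by (simp add: absent_def m(2) phase_exit)
  ultimately show "j \<in> {j \<in> {1..n}. absent j a}" by simp
qed

text \<open>Count pairs of a block and a missing letter by letters: each skip letter contributes
  \<open>k + 1\<close>, each of the \<open>n - 2 * r - 2\<close> letters from \<open>r + 2\<close>
  to \<open>n - r - 1\<close> contributes one.\<close>

lemma sum_card_present:
  "(\<Sum>j\<in>{1..n}. card (present j)) + (r * (k + 1) + (n - 2 * r - 2)) = n * n"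
proof -
  have "(\<Sum>a\<in>letters. card {j \<in> {1..n}. absent j a}) =
      (\<Sum>a\<in>{1..r}. k + 1) + (\<Sum>a\<in>{r + 2..n + 1}. of_bool (a < n - r))"
  proof -
    have "card {j \<in> {1..n}. absent j a} = k + 1" if "a \<in> {1..r}" for a
      using absent_skip_letter[OF that] exit_strict_mono[OF that]
      by (simp add: card_image strict_mono_imp_inj_on inj_on_subset)
    moreover have "card {j \<in> {1..n}. absent j a} = of_bool (a < n - r)" if "a \<in> {r + 2..n + 1}" for a
    proof -
      have "{j \<in> {1..n}. absent j a} = (if a < n - r then {a} else {})"
        using that by (auto simp: absent_def)
      then show ?thesis by simp
    qed
    ultimately show ?thesis unfolding letters_def by (subst sum.union_disjoint) auto
  qed
  also have "(\<Sum>a\<in>{r + 2..n + 1}. of_bool (a < n - r)) = card {r + 2..<n - r}"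
  proof -
    have "{r + 2..n + 1} \<inter> {a. a < n - r} = {r + 2..<n - r}" using n_ge by auto
    then show ?thesis by (simp only: sum_of_bool_eq finite_atLeastAtMost of_nat_id)
  qed
  finally have absent: "(\<Sum>a\<in>letters. card {j \<in> {1..n}. absent j a}) = r * (k + 1) + (n - 2 * r - 2)"
    by simp
  have "card (present j) + card {a \<in> letters. absent j a} = n" for j
  proof -
    have "letters = present j \<union> {a \<in> letters. absent j a}" by (auto simp: present_def)
    moreover have "present j \<inter> {a \<in> letters. absent j a} = {}" by (auto simp: present_def)
    ultimately show ?thesis using card_letters finite_letters by (metis card_Un_disjoint finite_Un)
  qed
  then have "n * n = (\<Sum>j\<in>{1..n}. card (present j) + card {a \<in> letters. absent j a})" by simp
  also have "\<dots> = (\<Sum>j\<in>{1..n}. card (present j)) + (\<Sum>j\<in>{1..n}. card {a \<in> letters. absent j a})"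
    by (rule sum.distrib)
  also have "(\<Sum>j\<in>{1..n}. card {a \<in> letters. absent j a}) = (\<Sum>a\<in>letters. card {j \<in> {1..n}. absent j a})"
    unfolding card_eq_sum by (rule sum.swap_restrict) (simp_all add: finite_letters)
  finally show ?thesis using absent by simp
qed

definition word :: "nat list" where
  "word = (r + 1) # concat (map (\<lambda>j. block j @ [r + 1]) [1..<Suc n])"

text \<open>To the block lengths come \<open>n + 1\<close> separators: \<open>n\<close> behind the
  blocks and one in front.\<close>

lemma length_word: "length word + r * (k - 1) = n\<^sup>2 + 3"
proof -
  have "length (block j) = card (present j)" for j
    using distinct_card[OF distinct_block, of j] by (simp add: set_block)
  then have "length word = 1 + (\<Sum>j\<leftarrow>[1..<Suc n]. card (present j) + 1)"
    by (simp add: word_def length_concat o_def del: upt_Suc)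
  also have "(\<Sum>j\<leftarrow>[1..<Suc n]. card (present j) + 1) = (\<Sum>j\<in>{1..n}. card (present j) + 1)"
    by (simp only: interv_sum_list_conv_sum_set_nat set_upt atLeastLessThanSuc_atLeastAtMost)
  also have "\<dots> = (\<Sum>j\<in>{1..n}. card (present j)) + n"
    by (simp only: sum.distrib) simp
  finally have "length word + (r * (k + 1) + (n - 2 * r - 2)) = 1 + n * n + n"
    using sum_card_present by simp
  moreover have "r * (k + 1) = r * (k - 1) + 2 * r"
  proof -
    have "k + 1 = (k - 1) + 2" using k_ge by simp
    then show ?thesis by (metis add_mult_distrib2 mult.commute)
  qed
  ultimately show ?thesis using n_ge by (simp add: power2_eq_square)
qed

lemma supersequence_word: "supersequence {1..n + 1} word"
proof -
  have "supersequence (insert (r + 1) letters) word"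
    unfolding word_def
  proof (rule supersequence_interleave[OF finite_letters card_letters _ _ block_fits_left block_fits_right])
    show "r + 1 \<notin> letters" by (auto simp: letters_def)
    show "set (block j) \<subseteq> letters" for j by (auto simp: set_block present_def)
  qed
  moreover have "insert (r + 1) letters = {1..n + 1}" using n_ge by (auto simp: letters_def)
  ultimately show ?thesis by simp
qed

end

theorem theorem23:
  fixes s n m :: nat and A :: "'a set"
  assumes "s \<ge> 1"
    and "n \<ge> 4 * s + 1"
    and "[int n = 3] (mod (2 * int s - 1))"
    and "m = n + 1"
    and "finite A" and "card A = m"
  shows "\<exists>xs. supersequence A xs \<and>
           real (length xs) =
             (real m)^2 - (5 * real s - 3) / (2 * real s - 1) * real m
               + (2 * (real s)^2 + 9 * real s - 7) / (2 * real s - 1)"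
proof -
  obtain r where s: "s = Suc r" using assms(1) by (cases s) auto
  have "(2 * int r + 1) dvd int n - 3"
    using assms(3) s by (simp add: cong_iff_dvd_diff algebra_simps)
  then obtain z where z: "int n - 3 = (2 * int r + 1) * z" by (auto elim: dvdE)
  \<comment> \<open>\<open>n \<ge> 4 * s + 1\<close> says
    \<open>n - 3 \<ge> 2 * (2 * r + 1)\<close>, which yields \<open>k \<ge> 2\<close>.\<close>
  have "(2 * int r + 1) * 2 \<le> (2 * int r + 1) * z" using assms(2) s z by simp
  moreover have "0 < 2 * int r + 1" by simp
  ultimately have "2 \<le> z" by (simp only: mult_le_cancel_left_pos)
  moreover define k where "k = nat z"
  ultimately have k: "z = int k" "k \<ge> 2" by auto
  then have "int n = int ((2 * r + 1) * k + 3)" using z by (simp add: algebra_simps)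
  then have n: "n = (2 * r + 1) * k + 3" by (simp only: of_nat_eq_iff)
  interpret skip_letters r k n by unfold_locales (use k n in auto)
  obtain f where f: "bij_betw f {1..n + 1} A"
    using finite_same_card_bij[of "{1..n + 1}" A] assms(4-6) by auto
  have "supersequence A (map f word)"
    using supersequence_map[OF supersequence_word, of f] f by (auto simp: bij_betw_def)
  moreover have "real (length (map f word)) = (real m)^2 - (5 * real s - 3) / (2 * real s - 1) * real m
               + (2 * (real s)^2 + 9 * real s - 7) / (2 * real s - 1)"
  proof -
    let ?D = "2 * real s - 1" and ?c = "5 * real s - 3" and ?d = "2 * (real s)^2 + 9 * real s - 7"
    have "real (length word + r * (k - 1)) = real (n\<^sup>2 + 3)" by (simp only: length_word)
    then have len: "real (length word) = (real n)\<^sup>2 + 3 - real r * (real k - 1)"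
      using k by (simp add: of_nat_diff)
    have n': "real n = (2 * real r + 1) * real k + 3" using n by (simp add: algebra_simps)
    have m': "real m = real n + 1" using assms(4) by simp
    \<comment> \<open>Clearing the denominator: both the claimed size and the length of
      \<open>word\<close> equal \<open>m^2 - (k * (5 * r + 2) + 4 - r)\<close>.\<close>
    have "?c * real m - ?d = ?D * (real k * (5 * real r + 2) + 4 - real r)"
      unfolding m' n' s by (simp add: power2_eq_square algebra_simps)
    moreover have "?D \<noteq> 0" using s by simp
    ultimately have "?c / ?D * real m - ?d / ?D = real k * (5 * real r + 2) + 4 - real r"
      by (metis diff_divide_distrib nonzero_mult_div_cancel_left times_divide_eq_left)
    moreover have "real (length word) = (real m)^2 - (real k * (5 * real r + 2) + 4 - real r)"
      unfolding len m' n' by (simp add: power2_eq_square algebra_simps)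
    ultimately show ?thesis by simp
  qed
  ultimately show ?thesis by blast
qed

end
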